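(* Let $c_{n,+}=(-1)^n\dfrac{a^{n(n+3)/2}}{\{n\}!}$ for $n\ge 0$, and let $\omega_+=\sum_{n=0}^\infty c_{n,+}R_n$. Then for every $x\in\mathcal B^{ev}$ one has $$\langle \omega_+,x\rangle=\langle t(x)\rangle ,$$ where $\langle\omega_+,x\rangle:=\sum_{n=0}^\infty c_{n,+}\langle R_n,x\rangle$ (a sum with only finitely many nonzero terms for each $x\in\mathcal B^{ev}$).
   Context: $A$ is an indeterminate, $a=A^2$, $\{n\}=a^n-a^{-n}$, $[n]=\{n\}/\{1\}$, $\{n\}!=\{1\}\{2\}\cdots\{n\}$ (with $\{0\}!=1$), and similarly $[n]!$. Scalars may be taken in $\mathbb Q(A)$ when denominators occur. $\mathcal B=\mathbb Z[A^{\pm1}][z]$ (the Kauffman bracket skein module of the solid torus, with $z$ the core); $\mathcal B^{ev}$ is the submodule generated by the even powers of $z$. The basis $\{e_i\}_{i\ge0}$ of $\mathcal B$ is defined by $e_0=1$, $e_1=z$, $e_i=ze_{i-1}-e_{i-2}$. The twist map $t:\mathcal B\to\mathcal B$ (induced by a full right-handed twist of the solid torus) is the $\mathbb Z[A^{\pm1}]$-linear map with $t(e_i)=\mu_ie_i$, $\mu_i=(-1)^iA^{i^2+2i}$. The symmetric bilinear form $\langle\ ,\ \rangle$ on $\mathcal B$ (cabling the zero-framed Hopf link and taking the Kauffman bracket) is determined by $\langle f(z),e_i\rangle=f(\lambda_i)\langle e_i\rangle$ for all $f(z)\in\mathcal B$, where $\lambda_i=-a^{i+1}-a^{-i-1}$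 and $\langle e_i\rangle=(-1)^i[i+1]$. One writes $\langle x\rangle=\langle x,1\rangle$. $R_n=\prod_{i=0}^{n-1}(z-\lambda_{2i})$ (with $R_0=1$). One has $\langle R_n,z^{2k}\rangle=0$ for $k<n$. *)

theory Defs
  imports
    "HOL-Computational_Algebra.Polynomial_Factorial"
    "HOL-Library.Groups_Big_Fun"
begin

section \<open>Scalars\<close>

text \<open>\<open>\<rat>(A)\<close>, realised as the fraction field of \<open>\<int>[A]\<close>.\<close>

type_synonym scalar = "int poly fract"

definition A_var :: scalar where
  "A_var = to_fract [:0, 1:]"

definition a_var :: scalar where
  "a_var = A_var ^ 2"

definition Laurent :: "scalar set" where
  "Laurent = {to_fract p / A_var ^ k | (p :: int poly) k. True}"

definition qbrace :: "nat \<Rightarrow> scalar" where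
  "qbrace n = a_var powi int n - a_var powi (- int n)"

definition qint :: "nat \<Rightarrow> scalar" where
  "qint n = qbrace n / qbrace 1"

definition qbrace_fact :: "nat \<Rightarrow> scalar" where
  "qbrace_fact n = (\<Prod>i = 1..n. qbrace i)"


section \<open>The skein module of the solid torus\<close>

text \<open>
  The ambient space is \<open>\<rat>(A)[z]\<close>; the skein module \<open>\<int>[A\<^sup>\<plusminus>\<^sup>1][z]\<close> sits in it as a lattice.
  The even part is its \<open>\<int>[A\<^sup>\<plusminus>\<^sup>1]\<close>-submodule generated by the \<open>z\<^sup>2\<^sup>k\<close>.
\<close>

definition z_var :: "scalar poly" where
  "z_var = [:0, 1:]"

definition skein :: "scalar poly set" where
  "skein = {f. \<forall>i. coeff f i \<in> Laurent}"

definition skein_even :: "scalar poly set" where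
  "skein_even = {\<Sum>k<N. smult (c k) (z_var ^ (2 * k)) | (N :: nat) c. \<forall>k<N. c k \<in> Laurent}"

fun e_basis :: "nat \<Rightarrow> scalar poly" where
  "e_basis 0 = 1"
| "e_basis (Suc 0) = z_var"
| "e_basis (Suc (Suc i)) = z_var * e_basis (Suc i) - e_basis i"

definition mu :: "nat \<Rightarrow> scalar" where
  "mu i = (-1) ^ i * A_var ^ (i ^ 2 + 2 * i)"

definition lam :: "nat \<Rightarrow> scalar" where
  "lam i = - (a_var powi (int i + 1)) - a_var powi (- int i - 1)"

definition bracket_e :: "nat \<Rightarrow> scalar" where
  "bracket_e i = (-1) ^ i * qint (i + 1)"

text \<open>
  The twist map and the bilinear form are given by their characterising properties, after
  extending scalars to \<open>\<rat>(A)\<close>. Existence and uniqueness are proved below, as is the fact that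
  on the lattice they are the only \<open>\<int>[A\<^sup>\<plusminus>\<^sup>1]\<close>-linear maps with the given values on the basis.
\<close>

definition is_twist :: "(scalar poly \<Rightarrow> scalar poly) \<Rightarrow> bool" where
  "is_twist t \<longleftrightarrow> Vector_Spaces.linear smult smult t \<and> (\<forall>i. t (e_basis i) = smult (mu i) (e_basis i))"

definition twist :: "scalar poly \<Rightarrow> scalar poly" where
  "twist = (THE t. is_twist t)"

definition is_hopf_form :: "(scalar poly \<Rightarrow> scalar poly \<Rightarrow> scalar) \<Rightarrow> bool" where
  "is_hopf_form b \<longleftrightarrow>
     (\<forall>f. Vector_Spaces.linear smult (*) (b f)) \<and>
     (\<forall>g. Vector_Spaces.linear smult (*) (\<lambda>f. b f g)) \<and>
     (\<forall>f g. b f g = b g f) \<and>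
     (\<forall>f i. b f (e_basis i) = poly f (lam i) * bracket_e i)"

definition hopf_form :: "scalar poly \<Rightarrow> scalar poly \<Rightarrow> scalar" where
  "hopf_form = (THE b. is_hopf_form b)"

definition bracket :: "scalar poly \<Rightarrow> scalar" where
  "bracket x = hopf_form x 1"

definition R_poly :: "nat \<Rightarrow> scalar poly" where
  "R_poly n = (\<Prod>i<n. z_var - [:lam (2 * i):])"


section \<open>The element \<open>\<omega>\<^sub>+\<close>\<close>

text \<open>The division by two is exact, since \<open>n (n + 3)\<close> is always even.\<close>

definition c_plus :: "nat \<Rightarrow> scalar" where
  "c_plus n = (-1) ^ n * (a_var ^ (n * (n + 3) div 2) / qbrace_fact n)"

text \<open>
  \<open>\<omega>\<^sub>+\<close> is an infinite formal sum, which enters only through its pairing. \<^const>\<open>Sum_any\<close> adds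
  up the nonzero terms, and is \<open>0\<close> if there are infinitely many of them; so it must be used
  together with the finiteness of the support.
\<close>

definition omega_plus_form :: "scalar poly \<Rightarrow> scalar" where
  "omega_plus_form x = Sum_any (\<lambda>n. c_plus n * hopf_form (R_poly n) x)"


section \<open>Well-definedness\<close>

lemma A_var_nonzero [simp]: "A_var \<noteq> 0"
  by (simp add: A_var_def)

lemma a_var_nonzero [simp]: "a_var \<noteq> 0"
  by (simp add: a_var_def)

lemma A_var_power: "A_var ^ k = to_fract (monom 1 k)"
proof (induction k)
  case 0
  show ?case by (simp add: monom_0 flip: one_pCons)
next
  case (Suc k)
  have "monom (1::int) (Suc k) = [:0, 1:] * monom 1 k"
    by (simp add: monom_Suc)
  then show ?case using Suc by (simp only: power_Suc A_var_def to_fract_mult)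
qed

lemma qbrace_nonzero:
  assumes "n > 0"
  shows "qbrace n \<noteq> 0"
proof
  assume "qbrace n = 0"
  then have "a_var ^ n * a_var ^ n = 1"
    by (simp add: qbrace_def power_int_minus field_simps)
  then have "A_var ^ (4 * n) = A_var ^ 0"
    by (simp add: a_var_def flip: power_mult power_add)
  then have "monom (1::int) (4 * n) = monom 1 0"
    by (simp only: A_var_power to_fract_eq_iff)
  then have "coeff (monom (1::int) (4 * n)) 0 = coeff (monom 1 0) 0"
    by simp
  then show False
    using assms by simp
qed

lemma qbrace_fact_nonzero: "qbrace_fact n \<noteq> 0"
  by (simp add: qbrace_fact_def qbrace_nonzero)

interpretation vsp: vector_space "smult :: scalar \<Rightarrow> scalar poly \<Rightarrow> scalar poly"
  by unfold_locales (simp_all add: smult_add_right smult_add_left)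

interpretation vss: vector_space "(*) :: scalar \<Rightarrow> scalar \<Rightarrow> scalar"
  by unfold_locales (simp_all add: algebra_simps)

interpretation vpp: vector_space_pair "smult :: scalar \<Rightarrow> scalar poly \<Rightarrow> scalar poly"
  "smult :: scalar \<Rightarrow> scalar poly \<Rightarrow> scalar poly" ..

interpretation vps: vector_space_pair "smult :: scalar \<Rightarrow> scalar poly \<Rightarrow> scalar poly"
  "(*) :: scalar \<Rightarrow> scalar \<Rightarrow> scalar" ..

lemma linear_pp_iff:
  fixes t :: "scalar poly \<Rightarrow> scalar poly"
  shows "Vector_Spaces.linear smult smult t \<longleftrightarrow>
    (\<forall>f g. t (f + g) = t f + t g) \<and> (\<forall>c f. t (smult c f) = smult c (t f))"
  using vsp.vector_space_axioms by (simp add: Vector_Spaces.linear_iff)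

lemma linear_ps_iff:
  fixes t :: "scalar poly \<Rightarrow> scalar"
  shows "Vector_Spaces.linear smult (*) t \<longleftrightarrow>
    (\<forall>f g. t (f + g) = t f + t g) \<and> (\<forall>c f. t (smult c f) = c * t f)"
  using vsp.vector_space_axioms vss.vector_space_axioms by (simp add: Vector_Spaces.linear_iff)

lemma e_basis_induct:
  assumes "\<And>i. coeff f i \<in> L"
    and "P 0"
    and "\<And>c i. c \<in> L \<Longrightarrow> P (smult c (e_basis i))"
    and "\<And>f g. P f \<Longrightarrow> P g \<Longrightarrow> P (f + g)"
  shows "P f"
  using assms
proof (induction f arbitrary: P)
  case 0
  then show ?case by blast
next
  case (pCons a f)
  have a: "a \<in> L" using pCons.prems(1)[of 0] by simp
  have f: "coeff f i \<in> L" for i using pCons.prems(1)[of "Suc i"] by simp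
  have step: "smult c (z_var * e_basis (Suc i)) =
      smult c (e_basis (Suc (Suc i))) + smult c (e_basis i)" for c i
    by (simp add: smult_diff_right)
  have "P (z_var * f)"
  proof (rule pCons.IH[of "\<lambda>g. P (z_var * g)"])
    show "P (z_var * smult c (e_basis i))" if "c \<in> L" for c i
    proof (cases i)
      case 0
      then show ?thesis using pCons.prems(3)[OF that, of "Suc 0"] by simp
    next
      case (Suc k)
      have "P (smult c (e_basis (Suc (Suc k))) + smult c (e_basis k))"
        using pCons.prems(3)[OF that] by (rule pCons.prems(4)) (rule pCons.prems(3)[OF that])
      then show ?thesis unfolding Suc step[symmetric] by (simp only: mult_smult_right)
    qed
  qed (use f pCons.prems in \<open>auto simp: distrib_left\<close>)
  moreover have "P (smult a (e_basis 0))" using pCons.prems(3) a by blast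
  moreover have "pCons a f = smult a (e_basis 0) + z_var * f"
    by (simp add: z_var_def)
  ultimately show ?case using pCons.prems(4) by simp
qed

lemma span_e_basis: "vsp.span (range e_basis) = UNIV"
proof -
  have "f \<in> vsp.span (range e_basis)" for f
    by (rule e_basis_induct[where L = UNIV])
      (auto intro!: vsp.span_add vsp.span_scale intro: vsp.span_base vsp.span_zero)
  then show ?thesis by blast
qed

lemma e_basis_monic: "coeff (e_basis n) n = 1 \<and> (\<forall>i>n. coeff (e_basis n) i = 0)"
proof (induction n rule: e_basis.induct)
  case (3 n)
  then show ?case by (auto simp: z_var_def coeff_pCons split: nat.splits)
qed (auto simp: z_var_def coeff_pCons split: nat.splits)

lemma inj_e_basis: "inj e_basis"
proof (rule injI)
  fix i j assume "e_basis i = e_basis j"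
  then show "i = j"
    using e_basis_monic[of i] e_basis_monic[of j]
    by (metis linorder_neqE_nat one_neq_zero)
qed

lemma independent_e_basis: "vsp.independent (range e_basis)"
proof -
  have *: "vsp.independent (e_basis ` {..<n})" for n
  proof (induction n)
    case (Suc n)
    have sub: "vsp.subspace {f. \<forall>i\<ge>n. coeff f i = 0}"
      by (auto simp: vsp.subspace_def)
    have "vsp.span (e_basis ` {..<n}) \<subseteq> {f. \<forall>i\<ge>n. coeff f i = 0}"
      by (rule vsp.span_minimal[OF _ sub]) (use e_basis_monic in force)
    then have "e_basis n \<notin> vsp.span (e_basis ` {..<n})"
      using e_basis_monic[of n] by auto
    then show ?case
      using Suc vsp.independent_insertI by (simp add: lessThan_Suc)
  qed (simp add: vsp.independent_empty)
  have "vsp.independent (\<Union> (range (\<lambda>n. e_basis ` {..<n})))"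
  proof (rule vsp.independent_Union_directed)
    fix c d assume "c \<in> range (\<lambda>n. e_basis ` {..<n})" "d \<in> range (\<lambda>n. e_basis ` {..<n})"
    then obtain m n where mn: "c = e_basis ` {..<m}" "d = e_basis ` {..<n}" by auto
    show "c \<subseteq> d \<or> d \<subseteq> c"
      unfolding mn by (cases "m \<le> n") (auto intro!: image_mono)
  qed (use * in auto)
  moreover have "\<Union> (range (\<lambda>n. e_basis ` {..<n})) = range e_basis" by blast
  ultimately show ?thesis by simp
qed

lemma ex_linear_pp:
  fixes v :: "nat \<Rightarrow> scalar poly"
  shows "\<exists>t. Vector_Spaces.linear smult smult t \<and> (\<forall>i. t (e_basis i) = v i)"
  using vpp.linear_independent_extend[OF independent_e_basis, of "\<lambda>x. v (inv e_basis x)"]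
  by (auto simp: inj_e_basis)

lemma ex_linear_ps:
  fixes v :: "nat \<Rightarrow> scalar"
  shows "\<exists>t. Vector_Spaces.linear smult (*) t \<and> (\<forall>i. t (e_basis i) = v i)"
  using vps.linear_independent_extend[OF independent_e_basis, of "\<lambda>x. v (inv e_basis x)"]
  by (auto simp: inj_e_basis)

lemma linear_pp_eqI:
  fixes t u :: "scalar poly \<Rightarrow> scalar poly"
  assumes "Vector_Spaces.linear smult smult t" "Vector_Spaces.linear smult smult u"
    and "\<And>i. t (e_basis i) = u (e_basis i)"
  shows "t f = u f"
  by (rule vpp.linear_eq_on[OF assms(1,2), where B = "range e_basis"])
    (use assms(3) span_e_basis in auto)

lemma linear_ps_eqI:
  fixes t u :: "scalar poly \<Rightarrow> scalar"
  assumes "Vector_Spaces.linear smult (*) t" "Vector_Spaces.linear smult (*) u"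
    and "\<And>i. t (e_basis i) = u (e_basis i)"
  shows "t f = u f"
  by (rule vps.linear_eq_on[OF assms(1,2), where B = "range e_basis"])
    (use assms(3) span_e_basis in auto)

lemma ex1_twist: "\<exists>!t. is_twist t"
proof -
  obtain t where "is_twist t"
    using ex_linear_pp[of "\<lambda>i. smult (mu i) (e_basis i)"] by (auto simp: is_twist_def)
  moreover have "u = t" if "is_twist u" "is_twist t" for t u
    by (rule ext, rule linear_pp_eqI) (use that in \<open>auto simp: is_twist_def\<close>)
  ultimately show ?thesis by blast
qed

lemma is_twist_twist: "is_twist twist"
  unfolding twist_def by (rule theI'[OF ex1_twist])

lemma qbrace_rec:
  "(a_var powi int m + a_var powi (- int m)) * qbrace (m * (k + 1)) = qbrace (m * (k + 2)) + qbrace (m * k)"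
proof -
  define q u p w where "q = a_var ^ m" and "u = inverse q" and "p = a_var ^ (m * k)" and "w = inverse p"
  have qu: "q * u = 1" by (simp add: q_def u_def)
  have qb: "qbrace n = a_var ^ n - inverse (a_var ^ n)" for n
    by (simp only: qbrace_def power_int_minus power_int_of_nat)
  have "qbrace (m * (k + 1)) = p * q - w * u"
    by (simp only: qb distrib_left power_add mult_1_right inverse_mult_distrib p_def q_def w_def u_def)
  moreover have "qbrace (m * (k + 2)) = p * q * q - w * u * u"
    by (simp only: qb distrib_left power_add mult_2_right inverse_mult_distrib p_def q_def w_def u_def
        mult.assoc)
  moreover have "qbrace (m * k) = p - w"
    by (simp only: qb p_def w_def)
  moreover have "a_var powi int m + a_var powi (- int m) = q + u"
    by (simp only: power_int_minus power_int_of_nat q_def u_def)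
  moreover have "(q + u) * (p * q - w * u) = p * q * q - w * u * u + (q * u) * (p - w)"
    by algebra
  ultimately show ?thesis by (simp only: qu mult_1_left)
qed

lemma e_basis_lam:
  "poly (e_basis j) (lam i) * qbrace (i + 1) = (-1) ^ j * qbrace ((i + 1) * (j + 1))"
proof -
  have lam: "lam i = - (a_var powi int (i + 1) + a_var powi (- int (i + 1)))"
  proof -
    have "int (i + 1) = int i + 1" "- int (i + 1) = - int i - 1" by simp_all
    then show ?thesis by (simp only: lam_def)
  qed
  show ?thesis
  proof (induction j rule: e_basis.induct)
    case 1
    show ?case by simp
  next
    case 2
    have "qbrace 0 = 0" by (simp add: qbrace_def)
    then have "lam i * qbrace (i + 1) = - qbrace ((i + 1) * 2)"
      unfolding lam mult_minus_left using qbrace_rec[of "i + 1" 0]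
      by (simp only: add_0 mult_0_right mult_1_right add_0_right)
    then show ?case by (simp add: z_var_def numeral_2_eq_2)
  next
    case (3 j)
    have "poly (e_basis (Suc (Suc j))) (lam i) * qbrace (i + 1) =
        lam i * (poly (e_basis (Suc j)) (lam i) * qbrace (i + 1)) - poly (e_basis j) (lam i) * qbrace (i + 1)"
    proof -
      have "poly z_var x = x" for x by (simp add: z_var_def)
      then show ?thesis by (simp only: e_basis.simps poly_diff poly_mult left_diff_distrib mult.assoc)
    qed
    also have "\<dots> = (-1) ^ j * ((a_var powi int (i + 1) + a_var powi (- int (i + 1)))
        * qbrace ((i + 1) * (Suc j + 1)) - qbrace ((i + 1) * (j + 1)))"
      unfolding 3 unfolding lam by (simp only: power_Suc mult_minus_left mult_minus_right mult_1_left
          right_diff_distrib minus_minus mult.left_commute)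
    also have "\<dots> = (-1) ^ j * qbrace ((i + 1) * (Suc (Suc j) + 1))"
    proof -
      have "Suc (Suc j) + 1 = Suc j + 2" "j + 1 = Suc j" by simp_all
      then show ?thesis using qbrace_rec[of "i + 1" "Suc j"] by (simp only: add_diff_cancel)
    qed
    finally show ?case by (simp only: power_Suc mult_minus_left minus_minus mult_1_left)
  qed
qed

lemma e_basis_lam_sym: "poly (e_basis j) (lam i) * bracket_e i = poly (e_basis i) (lam j) * bracket_e j"
proof -
  have "poly (e_basis j) (lam i) * bracket_e i =
      (-1) ^ i * ((-1) ^ j * qbrace ((i + 1) * (j + 1))) / qbrace 1" for i j
    by (simp only: bracket_e_def qint_def flip: e_basis_lam)
      (simp only: times_divide_eq_right mult.left_commute)
  from this[of j i] this[of i j] show ?thesis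
    by (simp only: mult.left_commute mult.commute)
qed

lemma ex1_hopf_form: "\<exists>!b. is_hopf_form b"
proof -
  have "\<forall>f. \<exists>t. Vector_Spaces.linear smult (*) t \<and> (\<forall>i. t (e_basis i) = poly f (lam i) * bracket_e i)"
    by (intro allI ex_linear_ps)
  then obtain b where lin: "\<And>f. Vector_Spaces.linear smult (*) (b f)"
    and b: "\<And>f i. b f (e_basis i) = poly f (lam i) * bracket_e i" by metis
  have blin: "b f (g + h) = b f g + b f h" "b f (smult c g) = c * b f g" for f g h c
    using lin[of f] by (simp_all only: linear_ps_iff)
  have lin_add: "Vector_Spaces.linear smult (*) (\<lambda>h. b f h + b g h)" for f g
    unfolding linear_ps_iff blin by (simp add: algebra_simps)
  have lin_scl: "Vector_Spaces.linear smult (*) (\<lambda>h. c * b f h)" for c f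
    unfolding linear_ps_iff blin by (simp only: distrib_left mult.left_commute simp_thms)
  have add: "b (f + g) h = b f h + b g h" for f g h
    by (rule linear_ps_eqI[OF lin lin_add]) (simp only: b poly_add distrib_right)
  have scl: "b (smult c f) h = c * b f h" for c f h
    by (rule linear_ps_eqI[OF lin lin_scl]) (simp only: b poly_smult mult.assoc)
  have lin': "Vector_Spaces.linear smult (*) (\<lambda>f. b f g)" for g
    by (simp add: linear_ps_iff add scl)
  have sym_ee: "b (e_basis j) (e_basis i) = b (e_basis i) (e_basis j)" for i j
    unfolding b by (rule e_basis_lam_sym)
  have sym_e: "b f (e_basis i) = b (e_basis i) f" for f i
    by (rule linear_ps_eqI[OF lin' lin]) (rule sym_ee)
  have sym: "b f g = b g f" for f g
    by (rule linear_ps_eqI[OF lin lin']) (rule sym_e)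
  have "is_hopf_form b"
    using lin lin' sym b unfolding is_hopf_form_def by blast
  moreover have "u = t" if "is_hopf_form u" "is_hopf_form t" for t u
    by (rule ext, rule ext, rule linear_ps_eqI) (use that in \<open>auto simp: is_hopf_form_def\<close>)
  ultimately show ?thesis by blast
qed

lemma is_hopf_form_hopf_form: "is_hopf_form hopf_form"
  unfolding hopf_form_def by (rule theI'[OF ex1_hopf_form])

lemma bracket_e_basis: "bracket (e_basis i) = bracket_e i"
proof -
  have "hopf_form (e_basis 0) (e_basis i) = bracket_e i"
    using is_hopf_form_hopf_form by (simp add: is_hopf_form_def del: e_basis.simps) simp
  then show ?thesis
    using is_hopf_form_hopf_form by (simp add: is_hopf_form_def bracket_def)
qed

text \<open>Compatibility with the lattice.\<close>

lemma Laurent_to_fract: "to_fract p \<in> Laurent"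
  unfolding Laurent_def by (rule CollectI, rule exI[of _ p], rule exI[of _ 0]) simp

lemma Laurent_mult: "x \<in> Laurent \<Longrightarrow> y \<in> Laurent \<Longrightarrow> x * y \<in> Laurent"
proof -
  assume "x \<in> Laurent" "y \<in> Laurent"
  then obtain p k q l where "x = to_fract p / A_var ^ k" "y = to_fract q / A_var ^ l"
    unfolding Laurent_def by blast
  then have "x * y = to_fract (p * q) / A_var ^ (k + l)"
    by (simp add: power_add)
  then show ?thesis unfolding Laurent_def by blast
qed

lemma Laurent_add: "x \<in> Laurent \<Longrightarrow> y \<in> Laurent \<Longrightarrow> x + y \<in> Laurent"
proof -
  assume "x \<in> Laurent" "y \<in> Laurent"
  then obtain p k q l where "x = to_fract p / A_var ^ k" "y = to_fract q / A_var ^ l"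
    unfolding Laurent_def by blast
  then have "x + y = to_fract (p * monom 1 l + q * monom 1 k) / A_var ^ (k + l)"
    by (simp add: A_var_power[symmetric] power_add field_simps)
  then show ?thesis unfolding Laurent_def by blast
qed

lemma Laurent_0: "0 \<in> Laurent"
  using Laurent_to_fract[of 0] by simp

lemma Laurent_1: "1 \<in> Laurent"
  using Laurent_to_fract[of 1] by simp

lemma Laurent_uminus: "x \<in> Laurent \<Longrightarrow> - x \<in> Laurent"
  using Laurent_mult[OF Laurent_to_fract[of "-1"], of x] by simp

lemma Laurent_A_power: "A_var ^ k \<in> Laurent"
  unfolding A_var_power by (rule Laurent_to_fract)

lemma Laurent_mu: "mu i \<in> Laurent"
  using Laurent_A_power Laurent_uminus[OF Laurent_A_power] unfolding mu_def
  by (cases "even i") auto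

lemma skein_add: "f \<in> skein \<Longrightarrow> g \<in> skein \<Longrightarrow> f + g \<in> skein"
  by (simp add: skein_def Laurent_add)

lemma skein_smult: "c \<in> Laurent \<Longrightarrow> f \<in> skein \<Longrightarrow> smult c f \<in> skein"
  by (simp add: skein_def Laurent_mult)

lemma skein_e_basis: "e_basis i \<in> skein"
proof (induction i rule: e_basis.induct)
  case (3 i)
  have "z_var * e_basis (Suc i) \<in> skein"
    using 3 by (auto simp: skein_def z_var_def coeff_pCons Laurent_0 split: nat.split)
  moreover have "smult (-1) (e_basis i) \<in> skein"
    using 3 Laurent_uminus[OF Laurent_1] by (intro skein_smult)
  ultimately have "z_var * e_basis (Suc i) + smult (-1) (e_basis i) \<in> skein"
    by (rule skein_add)
  then show ?case by simp
qed (auto simp: skein_def z_var_def coeff_pCons coeff_1 Laurent_0 Laurent_1 split: nat.split)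

lemma skein_even_subset: "skein_even \<subseteq> skein"
proof
  fix x assume "x \<in> skein_even"
  then obtain N c where x: "x = (\<Sum>k<N. smult (c k) (z_var ^ (2 * k)))"
    and c: "\<forall>k<N. c k \<in> Laurent"
    unfolding skein_even_def by blast
  have z: "z_var ^ m \<in> skein" for m
  proof (induction m)
    case 0
    show ?case using skein_e_basis[of 0] by simp
  next
    case (Suc m)
    then show ?case
      by (auto simp: skein_def z_var_def coeff_pCons Laurent_0 split: nat.split)
  qed
  have "(\<Sum>k<n. smult (c k) (z_var ^ (2 * k))) \<in> skein" if "n \<le> N" for n
    using that
  proof (induction n)
    case 0
    show ?case by (simp add: skein_def Laurent_0)
  next
    case (Suc n)
    then show ?case using c z by (auto intro!: skein_add skein_smult)
  qed
  then show "x \<in> skein" using x by simp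
qed

lemma twist_unique_on_skein:
  assumes "f \<in> skein"
    and "\<And>f g. f \<in> skein \<Longrightarrow> g \<in> skein \<Longrightarrow> t (f + g) = t f + t g"
    and "\<And>c f. c \<in> Laurent \<Longrightarrow> f \<in> skein \<Longrightarrow> t (smult c f) = smult c (t f)"
    and "\<And>i. t (e_basis i) = smult (mu i) (e_basis i)"
  shows "t f = twist f \<and> twist f \<in> skein"
proof -
  have tw: "twist (f + g) = twist f + twist g" "twist (smult c f) = smult c (twist f)"
    "twist (e_basis i) = smult (mu i) (e_basis i)" for f g c i
    using is_twist_twist by (simp_all add: is_twist_def linear_pp_iff)
  have gen: "smult c (e_basis i) \<in> skein \<and> t (smult c (e_basis i)) = twist (smult c (e_basis i))
      \<and> twist (smult c (e_basis i)) \<in> skein" if "c \<in> Laurent" for c i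
    using that assms(3,4) skein_e_basis skein_smult Laurent_mu tw(2,3) Laurent_mult by simp
  have "f \<in> skein \<and> t f = twist f \<and> twist f \<in> skein"
  proof (rule e_basis_induct[where L = Laurent and f = f])
    show "coeff f i \<in> Laurent" for i using assms(1) by (simp add: skein_def)
    show "0 \<in> skein \<and> t 0 = twist 0 \<and> twist 0 \<in> skein"
      using gen[OF Laurent_0] by simp
  qed (use gen skein_add tw(1) assms(2) in auto)
  then show ?thesis by blast
qed

lemma hopf_form_unique_on_skein:
  assumes "g \<in> skein"
    and "\<And>g h. g \<in> skein \<Longrightarrow> h \<in> skein \<Longrightarrow> u (g + h) = u g + u h"
    and "\<And>c g. c \<in> Laurent \<Longrightarrow> g \<in> skein \<Longrightarrow> u (smult c g) = c * u g"
    and "\<And>i. u (e_basis i) = poly f (lam i) * bracket_e i"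
  shows "u g = hopf_form f g"
proof -
  have hf: "hopf_form f (g + h) = hopf_form f g + hopf_form f h"
    "hopf_form f (smult c g) = c * hopf_form f g"
    "hopf_form f (e_basis i) = poly f (lam i) * bracket_e i" for g h c i
    using is_hopf_form_hopf_form by (simp_all add: is_hopf_form_def linear_ps_iff)
  have gen: "smult c (e_basis i) \<in> skein \<and> u (smult c (e_basis i)) = hopf_form f (smult c (e_basis i))"
    if "c \<in> Laurent" for c i
    using that assms(3,4) skein_e_basis skein_smult hf(2,3) by simp
  have "g \<in> skein \<and> u g = hopf_form f g"
  proof (rule e_basis_induct[where L = Laurent and f = g])
    show "coeff g i \<in> Laurent" for i using assms(1) by (simp add: skein_def)
    show "0 \<in> skein \<and> u 0 = hopf_form f 0"
      using gen[OF Laurent_0] by simp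
  qed (use gen skein_add hf(1) assms(2) in auto)
  then show ?thesis by blast
qed

end

(* Both sides are linear in x, so it suffices to take x = e_2m, where the pairing with R_n is the
   product of the differences lam (2m) - lam (2i), i < n, times the bracket of e_2m. With q = a^2
   the claim becomes the expansion of b^m, at b = q^(m+1), in the Newton basis
   (1 - b) (1 - bq) ... (1 - bq^(n-1)), which is the c = 0 case of the q-Chu-Vandermonde sum. *)

theory Submission
  imports Defs
begin

section \<open>The q-Pochhammer symbol (b; q)_n and the Newton expansion of b^m\<close>

definition qpoch :: "'a::field \<Rightarrow> 'a \<Rightarrow> nat \<Rightarrow> 'a" where
  "qpoch b q n = (\<Prod>i<n. 1 - b * q ^ i)"

lemma qpoch_0 [simp]: "qpoch b q 0 = 1"
  by (simp add: qpoch_def)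

lemma qpoch_Suc: "qpoch b q (Suc n) = qpoch b q n * (1 - b * q ^ n)"
  by (simp add: qpoch_def)

lemma qpoch_Suc_left: "qpoch b q (Suc n) = (1 - b) * qpoch (b * q) q n"
  unfolding qpoch_def prod.lessThan_Suc_shift by (simp add: mult.assoc)

lemma qpoch_q_nonzero:
  assumes "\<And>n. q ^ Suc n \<noteq> 1"
  shows "qpoch q q n \<noteq> 0"
  using assms by (simp add: qpoch_def)

text \<open>The factor with index i = m is 1 - q^m / q^m.\<close>

lemma qpoch_inverse_power_eq_0:
  assumes "q \<noteq> 0" "m < n"
  shows "qpoch (1 / q ^ m) q n = 0"
  unfolding qpoch_def using assms by (auto intro!: bexI[of _ m])

text \<open>The terminating q-Chu-Vandermonde series with c = 0 has the summands
  \<open>newton_coeff q m n * qpoch b q n\<close>, so these are the coordinates of b^m in the Newton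
  basis.\<close>

definition newton_coeff :: "'a::field \<Rightarrow> nat \<Rightarrow> nat \<Rightarrow> 'a" where
  "newton_coeff q m n = q ^ n * qpoch (1 / q ^ m) q n / qpoch q q n"

lemma newton_coeff_0 [simp]: "newton_coeff q m 0 = 1"
  by (simp add: newton_coeff_def)

lemma newton_coeff_eq_0: "q \<noteq> 0 \<Longrightarrow> m < n \<Longrightarrow> newton_coeff q m n = 0"
  by (simp add: newton_coeff_def qpoch_inverse_power_eq_0)

lemma newton_coeff_Suc_right:
  "newton_coeff q m (Suc n) = newton_coeff q m n * (q * (1 - q ^ n / q ^ m) / (1 - q ^ Suc n))"
  by (simp add: newton_coeff_def qpoch_Suc)

text \<open>This is what comparing coefficients in b^(m+1) = b * b^m must give, since b (b; q)_n =
  ((b; q)_n - (b; q)_(n+1)) / q^n.\<close>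

lemma newton_coeff_Suc_Suc:
  assumes q: "q \<noteq> 0" "\<And>n. q ^ Suc n \<noteq> 1"
  shows "q ^ Suc n * newton_coeff q (Suc m) (Suc n) = newton_coeff q m (Suc n) - q * newton_coeff q m n"
proof -
  define P Q u y where "P = qpoch (1 / q ^ m) q n" and "Q = qpoch q q n" and "u = q ^ m" and "y = q ^ n"
  have nz: "Q \<noteq> 0" "u \<noteq> 0" "1 - q * y \<noteq> 0"
    using qpoch_q_nonzero[OF q(2)] q(1) q(2)[of n] by (simp_all add: Q_def u_def y_def)
  \<comment> \<open>Peeling off the first factor shifts the base from 1 / q^(m+1) to 1 / q^m, so
    both sides share the factor \<open>P\<close>.\<close>
  have "qpoch (1 / q ^ Suc m) q (Suc n) = (1 - 1 / (q * u)) * P"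
    using q(1) by (simp add: qpoch_Suc_left P_def u_def)
  then have "q ^ Suc n * newton_coeff q (Suc m) (Suc n) = q * y * (q * y * ((1 - 1 / (q * u)) * P) / (Q * (1 - q * y)))"
    by (simp add: newton_coeff_def qpoch_Suc[of q] Q_def y_def)
  also have "\<dots> = q * y * (P * (1 - y / u)) / (Q * (1 - q * y)) - q * (y * P / Q)"
    using nz q(1) by (simp add: divide_simps) algebra
  also have "\<dots> = newton_coeff q m (Suc n) - q * newton_coeff q m n"
    by (simp add: newton_coeff_def qpoch_Suc P_def Q_def u_def y_def)
  finally show ?thesis .
qed

lemma power_eq_sum_newton_coeff:
  assumes q: "q \<noteq> 0" "\<And>n. q ^ Suc n \<noteq> 1"
  shows "b ^ m = (\<Sum>n\<le>m. newton_coeff q m n * qpoch b q n)"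
proof (induction m)
  case 0
  show ?case by simp
next
  case (Suc m)
  define g where "g n = newton_coeff q m n / q ^ n * qpoch b q n" for n
  define h where "h n = newton_coeff q m n / q ^ n * qpoch b q (Suc n)" for n
  \<comment> \<open>Write b q^n = 1 - (1 - b q^n); the second part extends the product by one
    factor.\<close>
  have expand: "b * (newton_coeff q m n * qpoch b q n) = g n - h n" for n
    using q(1) by (simp add: g_def h_def qpoch_Suc field_simps)
  have coeff: "newton_coeff q (Suc m) (Suc n) * qpoch b q (Suc n) = g (Suc n) - h n" for n
  proof -
    have "newton_coeff q (Suc m) (Suc n) = (newton_coeff q m (Suc n) - q * newton_coeff q m n) / q ^ Suc n"
      using newton_coeff_Suc_Suc[OF q, of n m] q(1) by (simp add: field_simps)
    also have "\<dots> = newton_coeff q m (Suc n) / q ^ Suc n - newton_coeff q m n / q ^ n"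
      using q(1) by (simp add: diff_divide_distrib)
    finally show ?thesis by (simp only: g_def h_def left_diff_distrib)
  qed
  have "b ^ Suc m = (\<Sum>n\<le>m. g n) - (\<Sum>n\<le>m. h n)"
    using Suc by (simp add: sum_distrib_left expand sum_subtractf)
  \<comment> \<open>The added top term is zero because the coefficients vanish beyond m. Splitting
    off g 0 = 1 then aligns \<open>g (Suc n)\<close> with \<open>h n\<close>.\<close>
  also have "(\<Sum>n\<le>m. g n) = (\<Sum>n\<le>Suc m. g n)"
    using newton_coeff_eq_0[OF q(1), of m "Suc m"] by (simp add: g_def)
  also have "\<dots> = 1 + (\<Sum>n\<le>m. g (Suc n))"
    by (subst sum.atMost_Suc_shift) (simp add: g_def)
  also have "\<dots> - (\<Sum>n\<le>m. h n) = 1 + (\<Sum>n\<le>m. newton_coeff q (Suc m) (Suc n) * qpoch b q (Suc n))"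
    by (simp add: coeff sum_subtractf)
  also have "\<dots> = (\<Sum>n\<le>Suc m. newton_coeff q (Suc m) n * qpoch b q n)"
    by (subst sum.atMost_Suc_shift) simp
  finally show ?case .
qed

section \<open>The scalars c_{n,+} and the differences of the lambdas, at q = a^2\<close>

lemma a_var_square_power_neq_1: "(a_var\<^sup>2) ^ Suc n \<noteq> 1"
proof
  assume "(a_var\<^sup>2) ^ Suc n = 1"
  then have "a_var ^ Suc n * a_var ^ Suc n = 1"
    by (simp only: power2_eq_square power_mult_distrib)
  then have "qbrace (Suc n) = 0"
    unfolding qbrace_def power_int_minus power_int_of_nat
    by (simp only: inverse_unique right_minus_eq)
  then show False using qbrace_nonzero[of "Suc n"] by simp
qed

lemma qbrace_eq: "qbrace n = a_var ^ n - 1 / a_var ^ n"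
  by (simp only: qbrace_def power_int_minus power_int_of_nat inverse_eq_divide)

lemma lam_even: "lam (2 * i) = - (a_var * (a_var ^ i)\<^sup>2) - 1 / (a_var * (a_var ^ i)\<^sup>2)"
proof -
  have "lam (2 * i) = - (a_var powi int (Suc (2 * i))) - a_var powi (- int (Suc (2 * i)))"
    unfolding lam_def by (rule arg_cong2[of _ _ _ _ "\<lambda>k l. - (a_var powi k) - a_var powi l"]) simp_all
  moreover have "a_var ^ Suc (2 * i) = a_var * (a_var ^ i)\<^sup>2"
    by (simp add: power_mult power2_eq_square power_mult_distrib)
  ultimately show ?thesis
    by (simp only: power_int_minus power_int_of_nat inverse_eq_divide)
qed

lemma qbrace_fact_Suc: "qbrace_fact (Suc n) = qbrace_fact n * qbrace (Suc n)"
  by (simp add: qbrace_fact_def)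

lemma c_plus_Suc: "c_plus (Suc n) = c_plus n * (- (a_var\<^sup>2 * a_var ^ n) / qbrace (Suc n))"
proof -
  \<comment> \<open>The increment is an explicit multiple of 2, so \<open>div 2\<close> splits and
    the exponent of a grows by n + 2.\<close>
  have "Suc n * (Suc n + 3) = n * (n + 3) + 2 * (n + 2)" by (simp add: algebra_simps)
  then have "Suc n * (Suc n + 3) div 2 = n * (n + 3) div 2 + (2 + n)" by simp
  then show ?thesis
    by (simp only: c_plus_def qbrace_fact_Suc power_add) simp
qed

text \<open>With x = a^m and y = a^n, the left side is the ratio of consecutive summands of the
  pairing. The difference of the lambdas factors as (1 - y^2/x^2) (1 - a^2 x^2 y^2) / (a y^2), and
  the stray powers of a and y cancel against those from {n+1}.\<close>

lemma term_ratio_identity: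
  fixes a x y :: "'a::field"
  assumes nz: "a \<noteq> 0" "x \<noteq> 0" "y \<noteq> 0" and D: "1 - a\<^sup>2 * y\<^sup>2 \<noteq> 0"
  shows "- (a\<^sup>2 * y) / (a * y - 1 / (a * y)) * ((- (a * x\<^sup>2) - 1 / (a * x\<^sup>2)) - (- (a * y\<^sup>2) - 1 / (a * y\<^sup>2)))
    = a\<^sup>2 * (1 - y\<^sup>2 / x\<^sup>2) / (1 - a\<^sup>2 * y\<^sup>2) * (1 - a\<^sup>2 * x\<^sup>2 * y\<^sup>2)"
proof -
  have brace: "a * y - 1 / (a * y) = - (1 - a\<^sup>2 * y\<^sup>2) / (a * y)"
    using nz by (simp add: field_simps power2_eq_square)
  have lam: "(- (a * x\<^sup>2) - 1 / (a * x\<^sup>2)) - (- (a * y\<^sup>2) - 1 / (a * y\<^sup>2)) =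
      (1 - y\<^sup>2 / x\<^sup>2) * (1 - a\<^sup>2 * x\<^sup>2 * y\<^sup>2) / (a * y\<^sup>2)"
    using nz by (simp add: field_simps power2_eq_square)
  have "- (a\<^sup>2 * y) / (- D / (a * y)) * (U * V / (a * y\<^sup>2)) = a\<^sup>2 * U / D * V"
    if "D \<noteq> 0" for D U V
    using nz that by (simp add: field_simps power2_eq_square)
  from this[OF D] show ?thesis unfolding brace lam .
qed

text \<open>On the right, the last factor is the new factor of (b; q)_(n+1) at b = q^(m+1); the rest
  is the ratio of consecutive Newton coefficients.\<close>

lemma c_plus_lam_step:
  "- (a_var\<^sup>2 * a_var ^ n) / qbrace (Suc n) * (lam (2 * m) - lam (2 * n)) =
    a_var\<^sup>2 * (1 - (a_var\<^sup>2) ^ n / (a_var\<^sup>2) ^ m) / (1 - (a_var\<^sup>2) ^ Suc n)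
      * (1 - (a_var\<^sup>2) ^ Suc m * (a_var\<^sup>2) ^ n)"
proof -
  have pow: "(a_var\<^sup>2) ^ k = (a_var ^ k)\<^sup>2" for k
    by (simp only: power_mult[symmetric] mult.commute)
  have "1 - a_var\<^sup>2 * (a_var ^ n)\<^sup>2 \<noteq> 0"
    using a_var_square_power_neq_1[of n] by (simp only: power_Suc pow right_minus_eq eq_commute not_False_eq_True)
  then show ?thesis
    unfolding qbrace_eq lam_even power_Suc pow
    by (intro term_ratio_identity power_not_zero a_var_nonzero)
qed

text \<open>Both sides equal 1 at n = 0 and have the same ratio of consecutive terms.\<close>

lemma c_plus_mult_prod_lam:
  "c_plus n * (\<Prod>i<n. lam (2 * m) - lam (2 * i)) =
    newton_coeff (a_var\<^sup>2) m n * qpoch ((a_var\<^sup>2) ^ Suc m) (a_var\<^sup>2) n"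
proof (induction n)
  case 0
  show ?case by (simp add: c_plus_def qbrace_fact_def)
next
  case (Suc n)
  have "c_plus (Suc n) * (\<Prod>i<Suc n. lam (2 * m) - lam (2 * i)) =
      (c_plus n * (\<Prod>i<n. lam (2 * m) - lam (2 * i)))
        * (- (a_var\<^sup>2 * a_var ^ n) / qbrace (Suc n) * (lam (2 * m) - lam (2 * n)))"
    by (simp only: c_plus_Suc prod.lessThan_Suc ac_simps)
  also have "\<dots> = newton_coeff (a_var\<^sup>2) m (Suc n) * qpoch ((a_var\<^sup>2) ^ Suc m) (a_var\<^sup>2) (Suc n)"
    unfolding Suc c_plus_lam_step newton_coeff_Suc_right qpoch_Suc by (simp only: ac_simps)
  finally show ?case .
qed

section \<open>The pairing and the twist on even basis elements, and extension by linearity\<close>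

lemma hopf_form_e_basis: "hopf_form f (e_basis i) = poly f (lam i) * bracket_e i"
  using is_hopf_form_hopf_form by (simp only: is_hopf_form_def)

lemma hopf_form_linear:
  "hopf_form f (g + h) = hopf_form f g + hopf_form f h"
  "hopf_form f (smult c g) = c * hopf_form f g"
  "hopf_form (g + h) f = hopf_form g f + hopf_form h f"
  "hopf_form (smult c g) f = c * hopf_form g f"
  using is_hopf_form_hopf_form by (simp_all add: is_hopf_form_def linear_ps_iff)

lemma twist_linear:
  "twist (f + g) = twist f + twist g"
  "twist (smult c f) = smult c (twist f)"
  using is_twist_twist by (simp_all add: is_twist_def linear_pp_iff)

lemma bracket_twist_e_basis: "bracket (twist (e_basis i)) = mu i * bracket_e i"
proof -
  have "twist (e_basis i) = smult (mu i) (e_basis i)"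
    using is_twist_twist by (simp only: is_twist_def)
  then show ?thesis
    using bracket_e_basis[of i] by (simp only: bracket_def hopf_form_linear)
qed

text \<open>Since A^4 = q, the exponent 4m(m+1) gives b^m at b = q^(m+1), the left side of the
  Newton expansion.\<close>

lemma mu_even: "mu (2 * m) = ((a_var\<^sup>2) ^ Suc m) ^ m"
proof -
  have "(2 * m)\<^sup>2 + 2 * (2 * m) = 2 * (2 * (Suc m * m))"
    by (simp add: power2_eq_square algebra_simps)
  then have "mu (2 * m) = A_var ^ (2 * (2 * (Suc m * m)))"
    by (simp only: mu_def power_mult) simp
  then show ?thesis by (simp only: a_var_def power_mult)
qed

lemma c_plus_hopf_form_R_poly:
  "c_plus n * hopf_form (R_poly n) (e_basis (2 * m)) =
    newton_coeff (a_var\<^sup>2) m n * qpoch ((a_var\<^sup>2) ^ Suc m) (a_var\<^sup>2) n * bracket_e (2 * m)"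
proof -
  have "poly (R_poly n) (lam (2 * m)) = (\<Prod>i<n. lam (2 * m) - lam (2 * i))"
    unfolding R_poly_def poly_prod by (simp add: z_var_def)
  then show ?thesis
    by (simp only: hopf_form_e_basis mult.assoc[symmetric] c_plus_mult_prod_lam)
qed

text \<open>Finite support and the value of the sum are kept in one predicate, because
  \<open>Sum_any\<close> is additive only under finiteness conditions. In this form both pass to
  linear combinations.\<close>

definition pairing_stabilises :: "scalar poly \<Rightarrow> bool" where
  "pairing_stabilises x \<longleftrightarrow>
    (\<exists>N. \<forall>n\<ge>N. c_plus n * hopf_form (R_poly n) x = 0 \<and>
      (\<Sum>k<n. c_plus k * hopf_form (R_poly k) x) = bracket (twist x))"

lemma pairing_stabilises_e_basis: "pairing_stabilises (e_basis (2 * m))"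
proof -
  let ?T = "\<lambda>n. c_plus n * hopf_form (R_poly n) (e_basis (2 * m))"
  have nz: "a_var\<^sup>2 \<noteq> 0" by simp
  have vanish: "?T n = 0" if "n > m" for n
    unfolding c_plus_hopf_form_R_poly newton_coeff_eq_0[OF nz that] by simp
  \<comment> \<open>This is the Newton expansion at b = q^(m+1), multiplied by the bracket of
    e_(2m).\<close>
  have total: "(\<Sum>k\<le>m. ?T k) = bracket (twist (e_basis (2 * m)))"
    unfolding c_plus_hopf_form_R_poly bracket_twist_e_basis mu_even
    by (simp only: power_eq_sum_newton_coeff[OF nz a_var_square_power_neq_1, of _ m] sum_distrib_right)
  have "(\<Sum>k<n. ?T k) = (\<Sum>k\<le>m. ?T k)" if "n > m" for n
    by (rule sum.mono_neutral_right) (use that vanish in auto)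
  then show ?thesis
    unfolding pairing_stabilises_def using vanish total by (intro exI[of _ "Suc m"]) auto
qed

lemma pairing_stabilises_0: "pairing_stabilises 0"
  using hopf_form_linear(2)[of _ 0 0] hopf_form_linear(4)[of 0 0] twist_linear(2)[of 0 0]
  by (simp add: pairing_stabilises_def bracket_def)

lemma pairing_stabilises_smult:
  assumes "pairing_stabilises x"
  shows "pairing_stabilises (smult c x)"
proof -
  obtain N where N: "\<And>n. n \<ge> N \<Longrightarrow> c_plus n * hopf_form (R_poly n) x = 0 \<and>
      (\<Sum>k<n. c_plus k * hopf_form (R_poly k) x) = bracket (twist x)"
    using assms unfolding pairing_stabilises_def by blast
  have "c_plus n * hopf_form (R_poly n) (smult c x) = 0 \<and>
      (\<Sum>k<n. c_plus k * hopf_form (R_poly k) (smult c x)) = bracket (twist (smult c x))"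
    if "n \<ge> N" for n
    using N[OF that]
    by (simp only: hopf_form_linear twist_linear bracket_def mult.left_commute[of _ c]
        mult_zero_right simp_thms flip: sum_distrib_left)
  then show ?thesis unfolding pairing_stabilises_def by blast
qed

lemma pairing_stabilises_add:
  assumes "pairing_stabilises x" "pairing_stabilises y"
  shows "pairing_stabilises (x + y)"
proof -
  obtain M where M: "\<And>n. n \<ge> M \<Longrightarrow> c_plus n * hopf_form (R_poly n) x = 0 \<and>
      (\<Sum>k<n. c_plus k * hopf_form (R_poly k) x) = bracket (twist x)"
    using assms(1) unfolding pairing_stabilises_def by blast
  obtain N where N: "\<And>n. n \<ge> N \<Longrightarrow> c_plus n * hopf_form (R_poly n) y = 0 \<and>
      (\<Sum>k<n. c_plus k * hopf_form (R_poly k) y) = bracket (twist y)"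
    using assms(2) unfolding pairing_stabilises_def by blast
  have "c_plus n * hopf_form (R_poly n) (x + y) = 0 \<and>
      (\<Sum>k<n. c_plus k * hopf_form (R_poly k) (x + y)) = bracket (twist (x + y))"
    if "n \<ge> max M N" for n
    using M[of n] N[of n] that
    by (simp only: hopf_form_linear twist_linear bracket_def distrib_left sum.distrib) simp
  then show ?thesis unfolding pairing_stabilises_def by blast
qed

section \<open>Even powers of z in terms of the even e_i\<close>

lemma z_var_square_mult_e_basis:
  "z_var\<^sup>2 * e_basis 0 = e_basis 2 + e_basis 0"
  "z_var\<^sup>2 * e_basis (Suc (Suc i)) =
    e_basis (Suc (Suc (Suc (Suc i)))) + smult 2 (e_basis (Suc (Suc i))) + e_basis i"
proof -
  show "z_var\<^sup>2 * e_basis 0 = e_basis 2 + e_basis 0"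
    by (simp add: numeral_2_eq_2)
  have two: "smult 2 f = f + f" for f :: "scalar poly"
    by (metis one_add_one smult_1_left smult_add_left)
  \<comment> \<open>The recursion in the form z e_j = e_(j+1) + e_(j-1) is applied twice.\<close>
  show "z_var\<^sup>2 * e_basis (Suc (Suc i)) =
      e_basis (Suc (Suc (Suc (Suc i)))) + smult 2 (e_basis (Suc (Suc i))) + e_basis i"
    unfolding two by (simp add: power2_eq_square algebra_simps)
qed

text \<open>Multiplication by z^2 preserves the span of the even e_i, which contains 1.\<close>

lemma z_var_even_power_in_span: "z_var ^ (2 * k) \<in> vsp.span (range (\<lambda>m. e_basis (2 * m)))"
proof (induction k)
  case 0
  have "e_basis (2 * 0) \<in> vsp.span (range (\<lambda>m. e_basis (2 * m)))"
    by (intro vsp.span_base rangeI)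
  then show ?case by simp
next
  case (Suc k)
  let ?S = "vsp.span (range (\<lambda>m. e_basis (2 * m)))"
  have base: "e_basis (2 * m) \<in> ?S" for m
    by (intro vsp.span_base rangeI)
  have gen: "z_var\<^sup>2 * e_basis (2 * m) \<in> ?S" for m
  proof (cases m)
    case 0
    show ?thesis
      using vsp.span_add[OF base[of 1] base[of 0]] z_var_square_mult_e_basis(1) 0
      by (simp del: e_basis.simps)
  next
    case (Suc j)
    have idx: "2 * m = Suc (Suc (2 * j))" "2 * Suc m = Suc (Suc (Suc (Suc (2 * j))))"
      using Suc by simp_all
    have "e_basis (2 * Suc m) + smult 2 (e_basis (2 * m)) + e_basis (2 * j) \<in> ?S"
      by (intro vsp.span_add vsp.span_scale base)
    then show ?thesis unfolding idx z_var_square_mult_e_basis(2) .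
  qed
  have "z_var\<^sup>2 * f \<in> ?S" if "f \<in> ?S" for f
    using that
  proof (induction rule: vsp.span_induct_alt)
    case base
    show ?case using vsp.span_zero by simp
  next
    case (step c f g)
    obtain m where "f = e_basis (2 * m)" using step.hyps(1) by blast
    then have "smult c (z_var\<^sup>2 * f) + z_var\<^sup>2 * g \<in> ?S"
      by (intro vsp.span_add vsp.span_scale step.IH) (simp only: gen)
    then show ?case by (simp only: distrib_left mult_smult_right)
  qed
  from this[OF Suc] show ?case by (simp add: power_add[symmetric] flip: power2_eq_square)
qed

text \<open>Passing from Laurent coefficients to the whole scalar field is harmless: the form and
  the twist are linear over that field.\<close>

lemma skein_even_subset_span: "skein_even \<subseteq> vsp.span (range (\<lambda>m. e_basis (2 * m)))"
  unfolding skein_even_def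
  by (auto intro!: vsp.span_sum vsp.span_scale z_var_even_power_in_span)

theorem theorem1p1:
  fixes x :: "scalar poly"
  assumes "x \<in> skein_even"
  shows "finite {n. c_plus n * hopf_form (R_poly n) x \<noteq> 0}
    \<and> omega_plus_form x = bracket (twist x)"
proof -
  let ?T = "\<lambda>n. c_plus n * hopf_form (R_poly n) x"
  have "x \<in> vsp.span (range (\<lambda>m. e_basis (2 * m)))"
    using assms skein_even_subset_span by blast
  then have "pairing_stabilises x"
  proof (induction rule: vsp.span_induct_alt)
    case base
    show ?case by (rule pairing_stabilises_0)
  next
    case (step c f g)
    obtain m where "f = e_basis (2 * m)" using step.hyps(1) by blast
    then show ?case
      using step.IH by (simp only: pairing_stabilises_add pairing_stabilises_smult pairing_stabilises_e_basis)
  qed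
  then obtain N where N: "\<And>n. n \<ge> N \<Longrightarrow> ?T n = 0" and total: "(\<Sum>k<N. ?T k) = bracket (twist x)"
    unfolding pairing_stabilises_def by blast
  have supp: "{n. ?T n \<noteq> 0} \<subseteq> {..<N}"
    using N by (metis (mono_tags, lifting) lessThan_iff mem_Collect_eq not_less subsetI)
  \<comment> \<open>The bound on the support turns \<open>Sum_any\<close> into an ordinary sum and
    excludes its default value 0 for infinite support.\<close>
  have "omega_plus_form x = (\<Sum>k<N. ?T k)"
    unfolding omega_plus_form_def by (rule Sum_any.expand_superset[OF _ supp]) simp
  then show ?thesis
    using finite_subset[OF supp] total by simp
qed

end
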